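(* ALSO-X$\underline{\#}$ is better than the CVaR approximation, i.e., $v^{A\underline{\#}}\le v^{\mathrm{CVaR}}$.
   Context: Data. $n,m,I$ are positive integers, $[I]=\{1,\dots,I\}$, $\mathcal X\subseteq\mathbb{R}^n$ is a deterministic set (not assumed convex), $c\in\mathbb{R}^n$, $\varepsilon\in(0,1)$, $\theta\ge 0$, $\|\cdot\|$ is a norm on $\mathbb{R}^m$ with dual norm $\|\cdot\|_*$. For $i\in[I]$, $a_i(x)=A_ix+a_i\in\mathbb{R}^m$ and $b_i(x)=B_i^\top x+b_i\in\mathbb{R}$ are affine. $\tilde\zeta$ is a random vector in $\mathbb{R}^m$ with reference distribution $\mathbb{P}_\zeta$, assumed sub-Gaussian: $\mathbb{P}_\zeta\{\|\tilde\zeta\|\ge\tau\}\le C_1\exp(-C_2\tau^2)$ for some constants $C_1,C_2>0$. $(y)_+=\max\{y,0\}$. Put $$g(x,\zeta)=\max_{i\in[I]}\big(\theta\|a_i(x)\|_*+a_i(x)^\top\zeta-b_i(x)\big).$$ The underlying problem (DRCCP under the type $\infty$-Wasserstein ambiguity set) is $\min\{c^\top x: x\in\mathcal X,\ \mathbb{P}_\zeta\{g(x,\tilde\zeta)\le0\}\ge1-\varepsilon\}$. CVaR approximation (bilevel form): $v^{\mathrm{CVaR}}$ is the minimum (infimum) of all $t$ for which there is $(x^*,\beta^* )\in\arg\min\{\varepsilon\beta+\mathbb{E}_{\mathbb{P}_\zeta}[(g(x,\tilde\zeta)-\beta)_+]: x\in\mathcal X,\ c^\top x\le t,\ \beta\le0\}$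 with $\varepsilon\beta^*+\mathbb{E}_{\mathbb{P}_\zeta}[(g(x^*,\tilde\zeta)-\beta^* )_+]\le 0$. ALSO-X$\underline{\#}$: $v^{A\underline{\#}}$ is the minimum (infimum) of all $t$ for which there is $(x^*,\beta^* )\in\arg\min\{\varepsilon\beta+\mathbb{E}_{\mathbb{P}_\zeta}[(g(x,\tilde\zeta)-\beta)_+]: x\in\mathcal X,\ c^\top x\le t,\ \beta\in\mathbb{R}\}$ with $\mathbb{P}_\zeta\{g(x^*,\tilde\zeta)\le0\}\ge1-\varepsilon$. Conventions: an infimum over the empty set is $+\infty$; the lower-level minimization problems (written with $\arg\min$) are understood to attain their minimum whenever they are feasible. *)

theory Defs
  imports "HOL-Probability.Probability"
begin

text \<open>An arbitrary norm on \<open>\<real>\<^sup>m\<close>, not necessarily the Euclidean one carried by the type.\<close>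

definition is_norm :: "(real ^ 'm \<Rightarrow> real) \<Rightarrow> bool" where
  "is_norm N \<longleftrightarrow>
     (\<forall>z. 0 \<le> N z) \<and> (\<forall>z. N z = 0 \<longleftrightarrow> z = 0) \<and>
     (\<forall>r z. N (r *\<^sub>R z) = \<bar>r\<bar> * N z) \<and> (\<forall>y z. N (y + z) \<le> N y + N z)"

definition dual_norm :: "(real ^ 'm \<Rightarrow> real) \<Rightarrow> real ^ 'm \<Rightarrow> real" where
  "dual_norm N y = (SUP z\<in>{z. N z \<le> 1}. y \<bullet> z)"

definition sub_gaussian :: "(real ^ 'm \<Rightarrow> real) \<Rightarrow> (real ^ 'm) measure \<Rightarrow> bool" where
  "sub_gaussian N P \<longleftrightarrow>
     (\<exists>C1>0. \<exists>C2>0. \<forall>\<tau>\<ge>0. measure P {\<zeta>. N \<zeta> \<ge> \<tau>} \<le> C1 * exp (- C2 * \<tau>\<^sup>2))"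

definition drccp_g ::
  "(real ^ 'm \<Rightarrow> real) \<Rightarrow> real \<Rightarrow> nat \<Rightarrow> (nat \<Rightarrow> real ^ 'n ^ 'm) \<Rightarrow> (nat \<Rightarrow> real ^ 'm) \<Rightarrow>
   (nat \<Rightarrow> real ^ 'n) \<Rightarrow> (nat \<Rightarrow> real) \<Rightarrow> real ^ 'n \<Rightarrow> real ^ 'm \<Rightarrow> real" where
  "drccp_g N \<theta> I A a B b x \<zeta> =
     (MAX i\<in>{1..I}. \<theta> * dual_norm N (A i *v x + a i) + (A i *v x + a i) \<bullet> \<zeta> - (B i \<bullet> x + b i))"

text \<open>The lower-level problem has decision variables \<open>(x, \<beta>)\<close>. The set \<open>T\<close> restricts \<open>\<beta>\<close>: it is
  \<open>{..0}\<close> for the CVaR approximation and \<open>UNIV\<close> for ALSO-X-underline-sharp.\<close>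

definition lower_obj ::
  "real \<Rightarrow> (real ^ 'm) measure \<Rightarrow> (real ^ 'n \<Rightarrow> real ^ 'm \<Rightarrow> real) \<Rightarrow> (real ^ 'n) \<times> real \<Rightarrow> real" where
  "lower_obj \<epsilon> P g = (\<lambda>(x, \<beta>). \<epsilon> * \<beta> + (\<integral>\<zeta>. max (g x \<zeta> - \<beta>) 0 \<partial>P))"

definition lower_feasible ::
  "(real ^ 'n) set \<Rightarrow> real ^ 'n \<Rightarrow> real set \<Rightarrow> real \<Rightarrow> (real ^ 'n) \<times> real \<Rightarrow> bool" where
  "lower_feasible X c T t = (\<lambda>(x, \<beta>). x \<in> X \<and> c \<bullet> x \<le> t \<and> \<beta> \<in> T)"

definition lower_attained ::
  "real \<Rightarrow> (real ^ 'm) measure \<Rightarrow> (real ^ 'n) set \<Rightarrow> real ^ 'n \<Rightarrow>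
   (real ^ 'n \<Rightarrow> real ^ 'm \<Rightarrow> real) \<Rightarrow> real set \<Rightarrow> bool" where
  "lower_attained \<epsilon> P X c g T \<longleftrightarrow>
     (\<forall>t. (\<exists>z. lower_feasible X c T t z) \<longrightarrow>
          (\<exists>z. is_arg_min (lower_obj \<epsilon> P g) (lower_feasible X c T t) z))"

text \<open>The optimal values are extended reals, so that the infimum of the empty set is \<open>\<infinity>\<close>.\<close>

definition v_CVaR ::
  "real \<Rightarrow> (real ^ 'm) measure \<Rightarrow> (real ^ 'n) set \<Rightarrow> real ^ 'n \<Rightarrow>
   (real ^ 'n \<Rightarrow> real ^ 'm \<Rightarrow> real) \<Rightarrow> ereal" where
  "v_CVaR \<epsilon> P X c g =
     (INF t\<in>{t. \<exists>x \<beta>. is_arg_min (lower_obj \<epsilon> P g) (lower_feasible X c {..0} t) (x, \<beta>) \<and>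
                     lower_obj \<epsilon> P g (x, \<beta>) \<le> 0}. ereal t)"

definition v_ALSOX_sharp ::
  "real \<Rightarrow> (real ^ 'm) measure \<Rightarrow> (real ^ 'n) set \<Rightarrow> real ^ 'n \<Rightarrow>
   (real ^ 'n \<Rightarrow> real ^ 'm \<Rightarrow> real) \<Rightarrow> ereal" where
  "v_ALSOX_sharp \<epsilon> P X c g =
     (INF t\<in>{t. \<exists>x \<beta>. is_arg_min (lower_obj \<epsilon> P g) (lower_feasible X c UNIV t) (x, \<beta>) \<and>
                     measure P {\<zeta>. g x \<zeta> \<le> 0} \<ge> 1 - \<epsilon>}. ereal t)"

end

theory Submission
  imports Defs
begin

text \<open>
  Every level \<open>t\<close> admitted in the CVaR problem is also admitted in ALSO-X-underline-sharp, so the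
  infimum defining the latter runs over a larger set. Indeed, if the CVaR minimum at \<open>t\<close> is
  nonpositive, then dropping the restriction \<open>\<beta> \<le> 0\<close> can only lower it, so a minimiser \<open>(x, \<beta>)\<close> of
  the unrestricted problem also has nonpositive objective. Because the expectation of a positive
  part is nonnegative, this forces \<open>\<beta> \<le> 0\<close>. If \<open>\<beta> < 0\<close>, Markov's inequality at height \<open>-\<beta>\<close> bounds
  the probability of \<open>g x \<zeta> > 0\<close> by \<open>\<epsilon>\<close>; if \<open>\<beta> = 0\<close>, the positive part of \<open>g x \<zeta>\<close> has
  expectation \<open>0\<close> and so vanishes almost surely (\<open>cvar_bound_imp_chance_constraint\<close>).

  The Bochner integral of a non-integrable function is \<open>0\<close> by convention, so the argument is sound
  only if \<open>g x\<close> is integrable. This is the role of the sub-Gaussian tail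
  (\<open>sub_gaussian_integrable\<close>): it makes the norm of \<open>\<zeta>\<close> integrable, \<open>g x\<close> being a maximum of
  finitely many affine functions of \<open>\<zeta>\<close>. As the tail is measured in an arbitrary norm, the proof
  uses that such a norm is continuous, hence measurable, and dominates a positive multiple of the
  Euclidean one.
\<close>

section \<open>Arbitrary norms on Euclidean space\<close>

lemma is_norm_continuous:
  fixes N :: "real ^ 'm \<Rightarrow> real"
  assumes "is_norm N"
  shows "continuous_on UNIV N"
proof (rule convex_on_continuous)
  show "convex_on UNIV N"
  proof (rule convex_onI)
    fix t :: real and x y :: "real ^ 'm"
    assume t: "0 < t" "t < 1"
    have "N ((1 - t) *\<^sub>R x + t *\<^sub>R y) \<le> N ((1 - t) *\<^sub>R x) + N (t *\<^sub>R y)"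
      using assms unfolding is_norm_def by blast
    also have "\<dots> = \<bar>1 - t\<bar> * N x + \<bar>t\<bar> * N y"
      using assms unfolding is_norm_def by simp
    finally show "N ((1 - t) *\<^sub>R x + t *\<^sub>R y) \<le> (1 - t) * N x + t * N y"
      using t by simp
  qed simp
qed simp

text \<open>By homogeneity the constant can be read off the minimum of \<open>N\<close> on the Euclidean unit sphere,
  which is attained by compactness and is positive by definiteness.\<close>

lemma is_norm_dominates_norm:
  fixes N :: "real ^ 'm \<Rightarrow> real"
  assumes "is_norm N"
  obtains k where "k > 0" "\<And>z. k * norm z \<le> N z"
proof -
  have "continuous_on (sphere 0 1) N"
    using is_norm_continuous[OF assms] continuous_on_subset by blast
  moreover have "sphere (0 :: real ^ 'm) 1 \<noteq> {}" by simp
  ultimately obtain z0 where z0: "z0 \<in> sphere 0 1" "\<And>y. y \<in> sphere 0 1 \<Longrightarrow> N z0 \<le> N y"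
    using continuous_attains_inf[of "sphere (0 :: real ^ 'm) 1" N] by auto
  have "z0 \<noteq> 0" using z0(1) by auto
  then have "N z0 > 0"
    using assms unfolding is_norm_def by (metis order_le_less)
  moreover have "N z0 * norm z \<le> N z" for z
  proof (cases "z = 0")
    case True
    then show ?thesis using assms unfolding is_norm_def by simp
  next
    case False
    then have "N z0 \<le> N ((1 / norm z) *\<^sub>R z)" by (intro z0(2)) simp
    also have "\<dots> = N z / norm z"
      using assms unfolding is_norm_def by simp
    finally show ?thesis using False by (simp add: field_simps)
  qed
  ultimately show ?thesis using that by blast
qed

section \<open>Integrability under a sub-Gaussian tail\<close>

text \<open>A discrete layer-cake argument: the expectation of \<open>f\<close> rounded up to an integer is the sum of
  the tail probabilities at the integers.\<close>

lemma integrable_if_summable_tail: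
  fixes f :: "'a \<Rightarrow> real"
  assumes "finite_measure M" and [measurable]: "f \<in> borel_measurable M"
    and nonneg: "\<And>x. 0 \<le> f x"
    and tail: "summable (\<lambda>n::nat. measure M {x \<in> space M. real n \<le> f x})"
  shows "integrable M f"
proof (rule integrableI_nonneg)
  interpret finite_measure M by fact
  let ?T = "\<lambda>n. {x \<in> space M. real n \<le> f x}"
  have "(\<integral>\<^sup>+x. ennreal (f x) \<partial>M) \<le> (\<integral>\<^sup>+x. of_nat (nat \<lceil>f x\<rceil>) \<partial>M)"
  proof (rule nn_integral_mono)
    fix x
    have "f x \<le> real (nat \<lceil>f x\<rceil>)" by linarith
    then show "ennreal (f x) \<le> of_nat (nat \<lceil>f x\<rceil>)"
      by (simp add: ennreal_of_nat_eq_real_of_nat ennreal_leI)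
  qed
  also have "\<dots> = (\<Sum>n. emeasure M {x \<in> space M. n < nat \<lceil>f x\<rceil>})"
    by (rule nn_integral_nat_function) simp
  also have "\<dots> \<le> (\<Sum>n. ennreal (measure M (?T n)))"
  proof (rule suminf_le)
    fix n
    have "{x \<in> space M. n < nat \<lceil>f x\<rceil>} \<subseteq> ?T n"
    proof safe
      fix x assume "n < nat \<lceil>f x\<rceil>"
      then show "real n \<le> f x" by linarith
    qed
    then have "emeasure M {x \<in> space M. n < nat \<lceil>f x\<rceil>} \<le> emeasure M (?T n)"
      by (rule emeasure_mono) measurable
    then show "emeasure M {x \<in> space M. n < nat \<lceil>f x\<rceil>} \<le> ennreal (measure M (?T n))"
      by (simp only: emeasure_eq_measure)
  qed (rule summableI)+
  also have "\<dots> < \<infinity>"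
    unfolding infinity_ennreal_def less_top[symmetric]
    by (rule ennreal_suminf_neq_top[OF tail measure_nonneg])
  finally show "(\<integral>\<^sup>+x. ennreal (f x) \<partial>M) < \<infinity>" .
qed (use nonneg in auto)

text \<open>The tail bound makes \<open>N\<close> integrable, and a constant multiple of \<open>N\<close> dominates the Euclidean
  norm.\<close>

lemma sub_gaussian_integrable:
  fixes P :: "(real ^ 'm) measure"
  assumes "finite_measure P" and sets[measurable_cong]: "sets P = sets borel"
    and N: "is_norm N" and sg: "sub_gaussian N P"
  shows "integrable P (\<lambda>\<zeta>. \<zeta>)"
proof -
  have space: "space P = UNIV"
    using sets_eq_imp_space_eq[OF sets] by simp
  have [measurable]: "N \<in> borel_measurable borel"
    using is_norm_continuous[OF N] by (rule borel_measurable_continuous_onI)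
  obtain C1 C2 where C: "C1 > 0" "C2 > 0"
    and tail: "\<And>\<tau>. 0 \<le> \<tau> \<Longrightarrow> measure P {\<zeta>. N \<zeta> \<ge> \<tau>} \<le> C1 * exp (- C2 * \<tau>\<^sup>2)"
    using sg unfolding sub_gaussian_def by auto
  have int_N: "integrable P N"
  proof (rule integrable_if_summable_tail)
    show "summable (\<lambda>n::nat. measure P {\<zeta> \<in> space P. real n \<le> N \<zeta>})"
    proof (rule summable_comparison_test)
      show "summable (\<lambda>n. C1 * exp (- C2) ^ n)"
        using C by (intro summable_mult summable_geometric) simp
      \<comment> \<open>At integers \<open>n\<close> one has \<open>n \<le> n\<^sup>2\<close>, so the Gaussian tail is below a geometric one.\<close>
      have "measure P {\<zeta>. real n \<le> N \<zeta>} \<le> C1 * exp (- C2) ^ n" for n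
      proof -
        have "real n \<le> (real n)\<^sup>2"
          by (cases n) (simp_all add: power2_eq_square)
        then have "exp (- C2 * (real n)\<^sup>2) \<le> exp (real n * - C2)"
          using C by simp
        then have "C1 * exp (- C2 * (real n)\<^sup>2) \<le> C1 * exp (- C2) ^ n"
          using C unfolding exp_of_nat_mult by simp
        then show ?thesis using tail[of "real n"] by simp
      qed
      then show "\<exists>n0. \<forall>n\<ge>n0. norm (measure P {\<zeta> \<in> space P. real n \<le> N \<zeta>}) \<le> C1 * exp (- C2) ^ n"
        by (simp add: space)
    qed
  qed (use N assms(1) in \<open>auto simp: is_norm_def\<close>)
  obtain k where k: "k > 0" "\<And>z. k * norm z \<le> N z"
    using is_norm_dominates_norm[OF N] by blast
  show ?thesis
  proof (rule Bochner_Integration.integrable_bound)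
    show "integrable P (\<lambda>\<zeta>. N \<zeta> / k)" using int_N by simp
    have "norm z \<le> norm (N z / k)" for z
    proof -
      have "norm z \<le> N z / k" using k by (simp add: pos_le_divide_eq mult.commute)
      also have "\<dots> \<le> norm (N z / k)" unfolding real_norm_def by (rule abs_ge_self)
      finally show ?thesis .
    qed
    then show "AE \<zeta> in P. norm \<zeta> \<le> norm (N \<zeta> / k)" by simp
  qed auto
qed

lemma integrable_drccp_g:
  assumes "prob_space P" and "integrable P (\<lambda>\<zeta>. \<zeta>)" and "I \<ge> 1"
  shows "integrable P (drccp_g N \<theta> I A a B b x)"
proof -
  interpret prob_space P by fact
  show ?thesis
    unfolding drccp_g_def using assms
    by (intro integrable_MAX Bochner_Integration.integrable_diff
        Bochner_Integration.integrable_add integrable_inner_right) auto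
qed

section \<open>From a nonpositive objective to the chance constraint\<close>

text \<open>The sign of \<open>\<beta>\<close> is a consequence of the bound rather than a constraint: since the integral is
  nonnegative, a positive \<open>\<beta>\<close> would make the left-hand side positive. This is why minimising over
  all real \<open>\<beta>\<close> loses nothing against \<open>\<beta> \<le> 0\<close>. For \<open>\<beta> < 0\<close> the bound reads
  \<open>E[(f - \<beta>)\<^sub>+] \<le> \<epsilon> (-\<beta>)\<close>, which is what Markov's inequality needs, as \<open>f > 0\<close> implies
  \<open>(f - \<beta>)\<^sub>+ \<ge> -\<beta>\<close>.\<close>

lemma (in prob_space) cvar_bound_imp_chance_constraint:
  fixes f :: "'a \<Rightarrow> real"
  assumes f: "integrable M f" and "0 < \<epsilon>"
    and obj: "\<epsilon> * \<beta> + (\<integral>x. max (f x - \<beta>) 0 \<partial>M) \<le> 0"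
  shows "prob {x \<in> space M. f x \<le> 0} \<ge> 1 - \<epsilon>"
proof -
  note [measurable] = borel_measurable_integrable[OF f]
  let ?u = "\<lambda>x. max (f x - \<beta>) 0"
  have u: "integrable M ?u"
    using f by (intro integrable_max) auto
  have "0 \<le> (\<integral>x. ?u x \<partial>M)" by (rule integral_nonneg_AE) simp
  with obj have "\<epsilon> * \<beta> \<le> 0" by linarith
  with \<open>0 < \<epsilon>\<close> have "\<beta> \<le> 0" by (simp add: mult_le_0_iff)
  have "prob {x \<in> space M. \<not> f x \<le> 0} \<le> \<epsilon>"
  proof (cases "\<beta> = 0")
    case True
    then have "(\<integral>x. ?u x \<partial>M) = 0"
      using obj \<open>0 \<le> (\<integral>x. ?u x \<partial>M)\<close> by (intro antisym) simp_all
    then have "AE x in M. ?u x = 0"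
      using integral_nonneg_eq_0_iff_AE[OF u] by simp
    then have "AE x in M. f x \<le> 0"
      by (rule eventually_mono) (use True in \<open>auto simp: max_def split: if_splits\<close>)
    then have "prob {x \<in> space M. \<not> f x \<le> 0} = 0"
      by (subst prob_eq_0) auto
    then show ?thesis using \<open>0 < \<epsilon>\<close> by simp
  next
    case False
    with \<open>\<beta> \<le> 0\<close> have "0 < - \<beta>" by simp
    have "prob {x \<in> space M. \<not> f x \<le> 0} \<le> prob {x \<in> space M. ?u x \<ge> - \<beta>}"
      by (intro finite_measure_mono) auto
    also have "\<dots> \<le> (\<integral>x. ?u x \<partial>M) / (- \<beta>)"
      using \<open>0 < - \<beta>\<close> by (intro integral_Markov_inequality_measure[OF u sets.empty_sets]) auto
    also have "\<dots> \<le> \<epsilon>"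
      using obj \<open>0 < - \<beta>\<close> by (subst pos_divide_le_eq) auto
    finally show ?thesis .
  qed
  then show ?thesis
    by (subst (asm) prob_neg) auto
qed

section \<open>Comparison of the two optimal values\<close>

theorem theorem3:
  fixes X :: "(real ^ 'n) set" and c :: "real ^ 'n"
    and \<epsilon> \<theta> :: real and I :: nat
    and N :: "real ^ 'm \<Rightarrow> real"
    and A :: "nat \<Rightarrow> real ^ 'n ^ 'm" and a :: "nat \<Rightarrow> real ^ 'm"
    and B :: "nat \<Rightarrow> real ^ 'n" and b :: "nat \<Rightarrow> real"
    and P :: "(real ^ 'm) measure"
  defines "g \<equiv> drccp_g N \<theta> I A a B b"
  assumes "I \<ge> 1" and "0 < \<epsilon>" and "\<epsilon> < 1" and "\<theta> \<ge> 0"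
    and "is_norm N"
    and "prob_space P" and "sets P = sets borel"
    and "sub_gaussian N P"
    and "lower_attained \<epsilon> P X c g {..0}"
    and "lower_attained \<epsilon> P X c g UNIV"
  shows "v_ALSOX_sharp \<epsilon> P X c g \<le> v_CVaR \<epsilon> P X c g"
proof -
  interpret prob_space P by fact
  have space: "space P = UNIV"
    using sets_eq_imp_space_eq[OF \<open>sets P = sets borel\<close>] by simp
  have g: "integrable P (g x)" for x
    unfolding g_def using assms
    by (intro integrable_drccp_g sub_gaussian_integrable) unfold_locales
  show ?thesis
    unfolding v_ALSOX_sharp_def v_CVaR_def
  proof (rule INF_superset_mono, safe)
    fix t x \<beta>
    assume cvar: "is_arg_min (lower_obj \<epsilon> P g) (lower_feasible X c {..0} t) (x, \<beta>)"
      and nonpos: "lower_obj \<epsilon> P g (x, \<beta>) \<le> 0"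
    from cvar have feas: "lower_feasible X c UNIV t (x, \<beta>)"
      by (simp add: is_arg_min_def lower_feasible_def)
    then obtain x' \<beta>' where
      min: "is_arg_min (lower_obj \<epsilon> P g) (lower_feasible X c UNIV t) (x', \<beta>')"
      using \<open>lower_attained \<epsilon> P X c g UNIV\<close> unfolding lower_attained_def by fast
    with feas have "lower_obj \<epsilon> P g (x', \<beta>') \<le> lower_obj \<epsilon> P g (x, \<beta>)"
      unfolding is_arg_min_linorder by blast
    with nonpos have "\<epsilon> * \<beta>' + (\<integral>\<zeta>. max (g x' \<zeta> - \<beta>') 0 \<partial>P) \<le> 0"
      by (simp add: lower_obj_def)
    from cvar_bound_imp_chance_constraint[OF g \<open>0 < \<epsilon>\<close> this]
    have "1 - \<epsilon> \<le> prob {\<zeta>. g x' \<zeta> \<le> 0}" by (simp add: space)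
    with min show "\<exists>x \<beta>. is_arg_min (lower_obj \<epsilon> P g) (lower_feasible X c UNIV t) (x, \<beta>) \<and>
        1 - \<epsilon> \<le> prob {\<zeta>. g x \<zeta> \<le> 0}" by blast
  qed
qed

end
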